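(* A permutation in $\mathcal{A}_n$ lies in a geodesic of the graph $X_n$ between $e$ and $w_0$ if and only if it is unimodal.
   Context: An interval in $\mathbb{Z}$ is a set $[a,b]=\{a,\dots,b\}$; an interval in $\mathbb{Z}_n$ is a subset of $\{1,\dots,n\}$ of the form $[a,b]$ or $[b,n]\cup[1,a]$ with $1\le a\le b\le n$. A permutation $\pi\in\mathcal{S}_n$ is an arc permutation if for every $1\le j\le n$ the set $\{\pi(1),\dots,\pi(j)\}$ is an interval in $\mathbb{Z}_n$; $\mathcal{A}_n$ is the set of arc permutations. A permutation is unimodal if either every prefix set $\{\pi(1),\dots,\pi(j)\}$, $1\le j\le n$, or every suffix set $\{\pi(j),\dots,\pi(n)\}$, $1\le j\le n$, is an interval in $\mathbb{Z}$. $X_n$ is the graph with vertex set $\mathcal{A}_n$ in which $u,v$ are adjacent iff $u=v\sigma_i$ for some adjacent transposition $\sigma_i=(i,i+1)$, $1\le i\le n-1$ (i.e. $u$ is obtained from $v$ by exchanging the letters in positions $i$ and $i+1$). $e=12\cdots n$ and $w_0=n\cdots21$. A geodesic between two vertices is a shortest path between them, endpoints included. *)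

theory Defs
  imports "HOL-Combinatorics.Permutations" "Graph_Theory.Graph_Theory"
begin

text \<open>
  The symmetric group on \<open>n\<close> letters is the set of all \<open>\<pi> :: nat \<Rightarrow> nat\<close> with
  \<open>\<pi> permutes {1..n}\<close>; such functions are the identity outside \<open>{1..n}\<close>.
  Products are compositions of functions, so \<open>v \<circ> transpose i (i + 1)\<close> is \<open>v\<close> with
  the letters in the positions \<open>i\<close> and \<open>i + 1\<close> exchanged.
\<close>

text \<open>Only sets of positive integers occur below, so intervals of integers are taken
  in type \<open>nat\<close>.\<close>

definition is_interval_Z :: "nat set \<Rightarrow> bool" where
  "is_interval_Z S \<longleftrightarrow> (\<exists>a b. a \<le> b \<and> S = {a..b})"

definition is_interval_Zn :: "nat \<Rightarrow> nat set \<Rightarrow> bool" where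
  "is_interval_Zn n S \<longleftrightarrow>
     (\<exists>a b. 1 \<le> a \<and> a \<le> b \<and> b \<le> n \<and> (S = {a..b} \<or> S = {b..n} \<union> {1..a}))"

definition arc_permutations :: "nat \<Rightarrow> (nat \<Rightarrow> nat) set" where
  "arc_permutations n =
     {\<pi>. \<pi> permutes {1..n} \<and> (\<forall>j\<in>{1..n}. is_interval_Zn n (\<pi> ` {1..j}))}"

definition unimodal :: "nat \<Rightarrow> (nat \<Rightarrow> nat) \<Rightarrow> bool" where
  "unimodal n \<pi> \<longleftrightarrow> \<pi> permutes {1..n} \<and>
     ((\<forall>j\<in>{1..n}. is_interval_Z (\<pi> ` {1..j})) \<or> (\<forall>j\<in>{1..n}. is_interval_Z (\<pi> ` {j..n})))"

definition longest_perm :: "nat \<Rightarrow> nat \<Rightarrow> nat" where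
  "longest_perm n i = (if i \<in> {1..n} then n + 1 - i else i)"

text \<open>An undirected graph is represented by a symmetric digraph.\<close>

definition arc_graph :: "nat \<Rightarrow> (nat \<Rightarrow> nat) pair_pre_digraph" where
  "arc_graph n =
     \<lparr> pverts = arc_permutations n,
       parcs = {(u, v). u \<in> arc_permutations n \<and> v \<in> arc_permutations n \<and>
                  (\<exists>i. 1 \<le> i \<and> i < n \<and> u = v \<circ> transpose i (i + 1))} \<rparr>"

lemma pair_graph_arc_graph: "pair_graph (arc_graph n)"
proof -
  have fin: "finite (arc_permutations n)"
    by (rule finite_subset[OF _ finite_permutations[of "{1..n}"]])
      (auto simp: arc_permutations_def)
  have "finite (parcs (arc_graph n))"
    by (rule finite_subset[of _ "arc_permutations n \<times> arc_permutations n"])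
      (use fin in \<open>auto simp: arc_graph_def\<close>)
  moreover have neq: "v \<circ> transpose i (i + 1) \<noteq> v" if "v \<in> arc_permutations n" for v i
  proof
    assume "v \<circ> transpose i (i + 1) = v"
    then have "v (i + 1) = v i"
      by (metis comp_apply transpose_apply_first)
    moreover have "inj v"
      using that by (auto simp: arc_permutations_def dest: permutes_inj)
    ultimately show False
      by (simp add: inj_eq)
  qed
  moreover have "fst a \<noteq> snd a" if "a \<in> parcs (arc_graph n)" for a
    using that neq unfolding arc_graph_def by fastforce
  moreover have "sym (parcs (arc_graph n))"
    by (rule symI) (auto simp: arc_graph_def comp_assoc)
  moreover have "pverts (arc_graph n) = arc_permutations n"
    "parcs (arc_graph n) \<subseteq> arc_permutations n \<times> arc_permutations n"
    by (auto simp: arc_graph_def)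
  ultimately show ?thesis
    using fin by unfold_locales (auto simp: symmetric_def)
qed

definition geodesic :: "('a, 'b) pre_digraph \<Rightarrow> 'a \<Rightarrow> 'a \<Rightarrow> 'a list \<Rightarrow> bool" where
  "geodesic G u v p \<longleftrightarrow> vpath p G \<and> hd p = u \<and> last p = v \<and>
     (\<forall>q. vpath q G \<and> hd q = u \<and> last q = v \<longrightarrow> vwalk_length p \<le> vwalk_length q)"

end

theory Submission
  imports Defs
begin

text \<open>
  An edge of \<open>X\<^sub>n\<close> changes the number of inversions by exactly one. Hence, once some path from
  \<open>e\<close> to \<open>w\<^sub>0\<close> ascends at every edge, the geodesics are precisely the ascending paths.

  A permutation whose prefixes are intervals of integers descends to \<open>e\<close> by exchanging its first
  descent. Left multiplication by \<open>w\<^sub>0\<close> reverses ascents and preserves this class, so it also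
  ascends to \<open>w\<^sub>0\<close>; right multiplication by \<open>w\<^sub>0\<close> handles permutations with interval suffixes.

  Conversely, an arc permutation \<open>\<pi>\<close> that is not unimodal has \<open>a = \<pi>(1)\<close> and \<open>b = \<pi>(n)\<close> both
  strictly between \<open>1\<close> and \<open>n\<close>. If \<open>a < b\<close>, the letters occur in the order \<open>a, 1, n, b\<close>, and
  no ascent inside \<open>X\<^sub>n\<close> can change this order: the only candidate exchanges \<open>1\<close> and \<open>n\<close>, and
  then the prefix ending at \<open>n\<close> separates \<open>{a, n}\<close> from the interleaved pair \<open>{1, b}\<close>. So
  \<open>w\<^sub>0\<close> is not reachable. If \<open>a > b\<close>, left multiplication by \<open>w\<^sub>0\<close> shows that \<open>\<pi>\<close> is not
  reachable from \<open>e\<close>.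
\<close>

section \<open>Inversions along edges\<close>

text \<open>The covering relation of the right weak order, restricted to arc permutations.\<close>

definition ascent_step :: "nat \<Rightarrow> (nat \<Rightarrow> nat) \<Rightarrow> (nat \<Rightarrow> nat) \<Rightarrow> bool" where
  "ascent_step n \<sigma> \<tau> \<longleftrightarrow> \<sigma> \<in> arc_permutations n \<and> \<tau> \<in> arc_permutations n \<and>
     (\<exists>i. 1 \<le> i \<and> i < n \<and> \<sigma> i < \<sigma> (i + 1) \<and> \<tau> = \<sigma> \<circ> transpose i (i + 1))"

text \<open>Inversions are recorded as pairs of letters, not of positions, so that an ascent step adds one
  pair and leaves all others in place.\<close>

definition inversions :: "(nat \<Rightarrow> nat) \<Rightarrow> (nat \<times> nat) set" where
  "inversions \<sigma> = {(x, y). x < y \<and> inv \<sigma> y < inv \<sigma> x}"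

lemma arc_permutations_permutes: "\<sigma> \<in> arc_permutations n \<Longrightarrow> \<sigma> permutes {1..n}"
  by (simp add: arc_permutations_def)

text \<open>No position lies between \<open>i\<close> and \<open>Suc i\<close>, so the exchange can
  reverse the order of these two only.\<close>

lemma transpose_Suc_strict_mono:
  assumes "u < v" "u = i \<Longrightarrow> v \<noteq> Suc i"
  shows "transpose i (Suc i) u < transpose i (Suc i) v"
  using assms by (auto simp: transpose_def split: if_splits)

lemma inv_comp_transpose:
  assumes "bij \<sigma>"
  shows "inv (\<sigma> \<circ> transpose i j) = transpose i j \<circ> inv \<sigma>"
  using assms by (simp add: o_inv_distrib)

text \<open>The position of each letter is passed through the transposition, which changes the order
  of the two exchanged letters only.\<close>

lemma inversions_comp_transpose:
  assumes "bij \<sigma>" and asc: "\<sigma> i < \<sigma> (i + 1)"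
  shows "inversions (\<sigma> \<circ> transpose i (i + 1)) = insert (\<sigma> i, \<sigma> (i + 1)) (inversions \<sigma>)"
    and "(\<sigma> i, \<sigma> (i + 1)) \<notin> inversions \<sigma>"
proof -
  let ?p = "inv \<sigma>" and ?s = "transpose i (Suc i)"
  have val: "\<sigma> (?p x) = x" and pos: "?p (\<sigma> k) = k" for x k
    using assms(1) by (simp_all add: bij_is_surj surj_f_inv_f bij_is_inj)
  have less: "?s (?p x) < ?s (?p y)" if "?p x < ?p y" "\<not> (x = \<sigma> i \<and> y = \<sigma> (Suc i))" for x y
    using transpose_Suc_strict_mono[of "?p x" "?p y" i] that val by metis
  have eq: "x = y \<longleftrightarrow> ?p x = ?p y" for x y
    using val by metis
  show "inversions (\<sigma> \<circ> transpose i (i + 1)) = insert (\<sigma> i, \<sigma> (i + 1)) (inversions \<sigma>)"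
  proof (rule set_eqI, clarify)
    fix x y
    show "(x, y) \<in> inversions (\<sigma> \<circ> transpose i (i + 1)) \<longleftrightarrow>
          (x, y) \<in> insert (\<sigma> i, \<sigma> (i + 1)) (inversions \<sigma>)"
    proof (cases "x = \<sigma> i \<and> y = \<sigma> (Suc i)")
      case True
      then show ?thesis
        using asc by (simp add: inversions_def inv_comp_transpose[OF assms(1)] pos)
    next
      case False
      have "?s (?p y) < ?s (?p x) \<longleftrightarrow> ?p y < ?p x" if "x < y"
      proof
        assume "?p y < ?p x"
        then show "?s (?p y) < ?s (?p x)"
          \<comment> \<open>The exception in \<open>less\<close> would make \<open>y, x\<close> the
            ascending pair at \<open>i\<close>, against \<open>x < y\<close>.\<close>
          using less[of y x] that asc by auto
      next
        assume *: "?s (?p y) < ?s (?p x)"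
        show "?p y < ?p x"
        proof (rule ccontr)
          assume "\<not> ?p y < ?p x"
          then have "?p x < ?p y"
            using eq[of x y] that by linarith
          from less[OF this False] * show False by simp
        qed
      qed
      with False show ?thesis
        by (auto simp: inversions_def inv_comp_transpose[OF assms(1)])
    qed
  qed
  show "(\<sigma> i, \<sigma> (i + 1)) \<notin> inversions \<sigma>"
    by (simp add: inversions_def pos)
qed

text \<open>Letters outside \<open>{1..n}\<close> are fixed and stay below or above the whole block,
  so no inversion involves them.\<close>

lemma finite_inversions:
  assumes "\<sigma> permutes {1..n}"
  shows "finite (inversions \<sigma>)"
proof (rule finite_subset)
  have inv: "inv \<sigma> permutes {1..n}"
    using assms by (rule permutes_inv)
  have inside: "inv \<sigma> x \<in> {1..n} \<longleftrightarrow> x \<in> {1..n}" for x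
    by (rule permutes_in_image[OF inv])
  have outside: "inv \<sigma> x = x" if "x \<notin> {1..n}" for x
    using inv that by (rule permutes_not_in)
  show "inversions \<sigma> \<subseteq> {1..n} \<times> {1..n}"
  proof clarify
    fix x y assume "(x, y) \<in> inversions \<sigma>"
    then have "x < y" "inv \<sigma> y < inv \<sigma> x"
      by (auto simp: inversions_def)
    then have "x \<in> {1..n} \<and> y \<in> {1..n}"
      using inside[of x] inside[of y] outside[of x] outside[of y]
      by (cases "x \<in> {1..n}"; cases "y \<in> {1..n}") (auto simp: not_le)
    then show "x \<in> {1..n} \<and> y \<in> {1..n}" .
  qed
qed simp

lemma card_inversions_comp_transpose:
  assumes "\<sigma> permutes {1..n}" "\<sigma> i < \<sigma> (i + 1)"
  shows "card (inversions (\<sigma> \<circ> transpose i (i + 1))) = Suc (card (inversions \<sigma>))"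
  using inversions_comp_transpose[OF permutes_bij[OF assms(1)] assms(2)] finite_inversions[OF assms(1)]
  by simp

lemma card_inversions_ascent_step:
  assumes "ascent_step n \<sigma> \<tau>"
  shows "card (inversions \<tau>) = Suc (card (inversions \<sigma>))"
  using assms card_inversions_comp_transpose arc_permutations_permutes
  unfolding ascent_step_def by metis

lemma ascent_step_arcD:
  assumes "ascent_step n \<sigma> \<tau>"
  shows "\<sigma> \<in> arc_permutations n" "\<tau> \<in> arc_permutations n"
  using assms by (auto simp: ascent_step_def)

lemma inversions_id: "inversions id = {}"
  by (auto simp: inversions_def)

text \<open>The two exchanged letters differ, so exactly one endpoint of the edge ascends
  there.\<close>

lemma arc_graph_arcD:
  assumes "(\<sigma>, \<tau>) \<in> parcs (arc_graph n)"
  shows "ascent_step n \<sigma> \<tau> \<or> ascent_step n \<tau> \<sigma>"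
proof -
  obtain i where *: "\<sigma> \<in> arc_permutations n" "\<tau> \<in> arc_permutations n" "1 \<le> i" "i < n"
    "\<sigma> = \<tau> \<circ> transpose i (i + 1)"
    using assms by (auto simp: arc_graph_def)
  then have \<tau>: "\<tau> = \<sigma> \<circ> transpose i (i + 1)"
    by (simp add: comp_assoc)
  have "\<tau> i \<noteq> \<tau> (i + 1)"
    using permutes_inj[OF arc_permutations_permutes[OF *(2)]] by (simp add: inj_eq)
  moreover have "\<sigma> i = \<tau> (i + 1)" "\<sigma> (i + 1) = \<tau> i"
    using *(5) by simp_all
  ultimately show ?thesis
    using * \<tau> unfolding ascent_step_def by (metis linorder_neqE_nat)
qed

lemma ascent_step_arc:
  assumes "ascent_step n \<sigma> \<tau>"
  shows "(\<sigma>, \<tau>) \<in> parcs (arc_graph n)"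
  using assms by (auto simp: ascent_step_def arc_graph_def comp_assoc)

section \<open>Walks and the number of inversions\<close>

lemma successively_card_inversions:
  assumes "successively (ascent_step n) p" "k < length p"
  shows "card (inversions (p ! k)) = card (inversions (hd p)) + k"
  using assms
proof (induction p arbitrary: k)
  case (Cons \<sigma> p)
  show ?case
  proof (cases k)
    case (Suc l)
    with Cons.prems have "p \<noteq> []" "l < length p" by auto
    with Cons Suc show ?thesis
      by (auto simp: successively_Cons card_inversions_ascent_step)
  qed simp
qed simp

lemma vwalk_arcs_successively:
  "set (vwalk_arcs p) \<subseteq> {(x, y). R x y} \<longleftrightarrow> successively R p"
  by (induction p rule: vwalk_arcs.induct) auto

text \<open>The growing number of inversions forbids repeated vertices. The hypothesis on
  \<open>hd p\<close> covers one-vertex lists, which contain no step.\<close>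

lemma ascending_vpath:
  assumes "successively (ascent_step n) p" "p \<noteq> []" "hd p \<in> arc_permutations n"
  shows "vpath p (with_proj (arc_graph n))"
    and "card (inversions (last p)) = card (inversions (hd p)) + vwalk_length p"
proof -
  have "set p \<subseteq> arc_permutations n"
    using assms
  proof (induction p)
    case (Cons \<sigma> p)
    then show ?case
      using ascent_step_arcD(2)[of n \<sigma> "hd p"] by (cases "p = []") (auto simp: successively_Cons)
  qed simp
  moreover have "set (vwalk_arcs p) \<subseteq> parcs (arc_graph n)"
    using assms(1) ascent_step_arc unfolding vwalk_arcs_successively[symmetric] by blast
  ultimately have "vwalk p (with_proj (arc_graph n))"
    using assms(2) by (intro vwalkI) (auto simp: arc_graph_def)
  moreover have "distinct p"
    unfolding distinct_conv_nth
  proof clarify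
    fix i j assume "i < length p" "j < length p" "i \<noteq> j" "p ! i = p ! j"
    then show False
      using successively_card_inversions[OF assms(1), of i]
        successively_card_inversions[OF assms(1), of j] by simp
  qed
  ultimately show "vpath p (with_proj (arc_graph n))" by (rule vpathI)
  show "card (inversions (last p)) = card (inversions (hd p)) + vwalk_length p"
    using successively_card_inversions[OF assms(1), of "length p - 1"] assms(2)
    by (simp add: last_conv_nth)
qed

text \<open>Each edge gains at most one inversion, and the bound is attained only if none loses
  one.\<close>

lemma vwalk_inversions_le:
  assumes "vwalk p (with_proj (arc_graph n))"
  shows "card (inversions (last p)) \<le> card (inversions (hd p)) + vwalk_length p"
    and "card (inversions (last p)) = card (inversions (hd p)) + vwalk_length p
           \<Longrightarrow> successively (ascent_step n) p"
proof -
  have "p \<noteq> []" "set (vwalk_arcs p) \<subseteq> parcs (arc_graph n)"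
    using assms by (auto simp: vwalk_def)
  then have "card (inversions (last p)) \<le> card (inversions (hd p)) + (length p - 1) \<and>
    (card (inversions (last p)) = card (inversions (hd p)) + (length p - 1)
       \<longrightarrow> successively (ascent_step n) p)"
  proof (induction p rule: vwalk_arcs.induct)
    case (3 \<sigma> \<tau> p)
    then have IH: "card (inversions (last (\<tau> # p))) \<le> card (inversions \<tau>) + length p"
      "card (inversions (last (\<tau> # p))) = card (inversions \<tau>) + length p
         \<Longrightarrow> successively (ascent_step n) (\<tau> # p)"
      by auto
    from 3 have "ascent_step n \<sigma> \<tau> \<or> ascent_step n \<tau> \<sigma>"
      by (intro arc_graph_arcD) auto
    then show ?case
    proof
      assume step: "ascent_step n \<sigma> \<tau>"
      with IH card_inversions_ascent_step[OF step] show ?thesis by simp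
    next
      assume "ascent_step n \<tau> \<sigma>"
      \<comment> \<open>A descending edge misses the bound by two, so the premise of the equality
        claim fails.\<close>
      from IH(1) card_inversions_ascent_step[OF this] show ?thesis by simp
    qed
  qed auto
  then show "card (inversions (last p)) \<le> card (inversions (hd p)) + vwalk_length p"
    and "card (inversions (last p)) = card (inversions (hd p)) + vwalk_length p
           \<Longrightarrow> successively (ascent_step n) p"
    by simp_all
qed

section \<open>Reachability and chains\<close>

lemma rtranclp_imp_successively:
  assumes "R\<^sup>*\<^sup>* x y"
  obtains p where "successively R p" "p \<noteq> []" "hd p = x" "last p = y"
proof -
  from assms have "\<exists>p. successively R p \<and> p \<noteq> [] \<and> hd p = x \<and> last p = y"
  proof (induction rule: converse_rtranclp_induct)
    case base
    show ?case by (rule exI[of _ "[y]"]) simp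
  next
    case (step x z)
    then obtain p where "successively R p" "p \<noteq> []" "hd p = z" "last p = y" by blast
    with step show ?case by (intro exI[of _ "x # p"]) (simp add: successively_Cons)
  qed
  with that show thesis by blast
qed

lemma successively_imp_rtranclp:
  assumes "successively R (x # p)"
  shows "R\<^sup>*\<^sup>* x (last (x # p))"
  using assms
proof (induction p arbitrary: x)
  case (Cons y p)
  then show ?case by (auto intro: converse_rtranclp_into_rtranclp)
qed simp

lemma rtranclp_through_imp_successively:
  assumes "R\<^sup>*\<^sup>* x y" "R\<^sup>*\<^sup>* y z"
  obtains p where "successively R p" "p \<noteq> []" "hd p = x" "last p = z" "y \<in> set p"
proof -
  obtain p where p: "successively R p" "p \<noteq> []" "hd p = x" "last p = y"
    using assms(1) by (rule rtranclp_imp_successively)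
  obtain q where q: "successively R q" "q \<noteq> []" "hd q = y" "last q = z"
    using assms(2) by (rule rtranclp_imp_successively)
  \<comment> \<open>Both chains contain \<open>y\<close> at the junction; \<open>tl\<close> drops
    the second copy.\<close>
  have "successively R (p @ tl q)" "p @ tl q \<noteq> []" "hd (p @ tl q) = x"
    "last (p @ tl q) = z" "y \<in> set (p @ tl q)"
    using p q by (cases q; auto simp: successively_append_iff successively_Cons)+
  then show thesis by (rule that)
qed

lemma successively_through_imp_rtranclp:
  assumes "successively R p" "y \<in> set p"
  shows "R\<^sup>*\<^sup>* (hd p) y" "R\<^sup>*\<^sup>* y (last p)"
proof -
  obtain xs ys where p: "p = xs @ y # ys"
    using assms(2) by (meson split_list)
  show "R\<^sup>*\<^sup>* y (last p)"
    using assms(1) successively_imp_rtranclp[of R y ys] by (simp add: p successively_append_iff)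
  have "successively R (xs @ [y])"
    using assms(1) by (auto simp: p successively_append_iff)
  then show "R\<^sup>*\<^sup>* (hd p) y"
    using successively_imp_rtranclp[of R "hd (xs @ [y])" "tl (xs @ [y])"]
    by (cases xs) (auto simp: p)
qed

section \<open>Multiplication by the longest permutation\<close>

lemma longest_perm_invol [simp]: "longest_perm n (longest_perm n i) = i"
  by (auto simp: longest_perm_def)

lemma longest_perm_comp_invol [simp]: "longest_perm n \<circ> longest_perm n = id"
  by auto

lemma longest_perm_permutes: "longest_perm n permutes {1..n}"
proof (rule bij_imp_permutes)
  show "bij_betw (longest_perm n) {1..n} {1..n}"
    by (rule bij_betw_byWitness[where f' = "longest_perm n"]) (auto simp: longest_perm_def)
qed (auto simp: longest_perm_def)

lemma longest_perm_image_atLeastAtMost: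
  assumes "1 \<le> a" "b \<le> n"
  shows "longest_perm n ` {a..b} = {n + 1 - b..n + 1 - a}"
proof
  show "longest_perm n ` {a..b} \<subseteq> {n + 1 - b..n + 1 - a}"
    using assms by (auto simp: longest_perm_def)
  show "{n + 1 - b..n + 1 - a} \<subseteq> longest_perm n ` {a..b}"
  proof
    fix x assume "x \<in> {n + 1 - b..n + 1 - a}"
    then have "longest_perm n x \<in> {a..b}"
      using assms by (auto simp: longest_perm_def)
    then show "x \<in> longest_perm n ` {a..b}"
      by (metis imageI longest_perm_invol)
  qed
qed

section \<open>Symmetries of cyclic intervals, arc permutations and ascents\<close>

lemma is_interval_Zn_atLeastAtMost: "1 \<le> a \<Longrightarrow> a \<le> b \<Longrightarrow> b \<le> n \<Longrightarrow> is_interval_Zn n {a..b}"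
  unfolding is_interval_Zn_def by blast

lemma is_interval_Zn_wrap:
  "1 \<le> a \<Longrightarrow> a \<le> b \<Longrightarrow> b \<le> n \<Longrightarrow> is_interval_Zn n ({b..n} \<union> {1..a})"
  unfolding is_interval_Zn_def by blast

text \<open>Reversing the circle maps arcs to arcs; the two pieces of a wrapping interval trade
  places.\<close>

lemma is_interval_Zn_longest_perm:
  assumes "is_interval_Zn n S"
  shows "is_interval_Zn n (longest_perm n ` S)"
proof -
  obtain a b where ab: "1 \<le> a" "a \<le> b" "b \<le> n" "S = {a..b} \<or> S = {b..n} \<union> {1..a}"
    using assms unfolding is_interval_Zn_def by blast
  have "longest_perm n ` {a..b} = {n + 1 - b..n + 1 - a}"
    "longest_perm n ` {b..n} = {1..n + 1 - b}" "longest_perm n ` {1..a} = {n + 1 - a..n}"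
    using ab(1-3) longest_perm_image_atLeastAtMost[of a b n] longest_perm_image_atLeastAtMost[of b n n]
      longest_perm_image_atLeastAtMost[of 1 a n] by simp_all
  then have "longest_perm n ` S = {n + 1 - b..n + 1 - a} \<or>
        longest_perm n ` S = {n + 1 - a..n} \<union> {1..n + 1 - b}"
    using ab(4) by (metis image_Un sup_commute)
  moreover have "1 \<le> n + 1 - b" "n + 1 - b \<le> n + 1 - a" "n + 1 - a \<le> n"
    using ab(1-3) by auto
  ultimately show ?thesis
    unfolding is_interval_Zn_def by blast
qed

text \<open>The complement of an arc of a circle is an arc. The full set is excluded because the
  empty set is not an interval here.\<close>

lemma is_interval_Zn_Compl:
  assumes "is_interval_Zn n S" "S \<noteq> {1..n}"
  shows "is_interval_Zn n ({1..n} - S)"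
proof -
  obtain a b where ab: "1 \<le> a" "a \<le> b" "b \<le> n" "S = {a..b} \<or> S = {b..n} \<union> {1..a}"
    using assms(1) unfolding is_interval_Zn_def by blast
  show ?thesis
  proof (cases "S = {a..b}")
    case True
    consider "a = 1" | "b = n" | "1 < a" "b < n"
      using ab by linarith
    then show ?thesis
    proof cases
      case 1
      then have "{1..n} - S = {b + 1..n}" "b + 1 \<le> n"
        using True ab(1-3) assms(2) by auto
      then show ?thesis
        using is_interval_Zn_atLeastAtMost[of "b + 1" n n] by simp
    next
      case 2
      then have "{1..n} - S = {1..a - 1}" "1 \<le> a - 1"
        using True ab(1-3) assms(2) by (auto simp: Suc_le_eq)
      then show ?thesis
        using is_interval_Zn_atLeastAtMost[of 1 "a - 1" n] ab(2,3) by simp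
    next
      case 3
      then have "{1..n} - S = {b + 1..n} \<union> {1..a - 1}"
        using True ab(1-3) by auto
      then show ?thesis
        using is_interval_Zn_wrap[of "a - 1" "b + 1" n] ab(2) 3 by simp
    qed
  next
    case False
    then have S: "S = {b..n} \<union> {1..a}"
      using ab by blast
    \<comment> \<open>Otherwise the two pieces meet and cover the circle, leaving no gap.\<close>
    have "\<not> b \<le> a + 1"
    proof
      assume "b \<le> a + 1"
      then have "{b..n} \<union> {1..a} = {1..n}"
        using ab(1-3) by auto
      with S assms(2) show False by simp
    qed
    moreover have "{1..n} - S = {a + 1..b - 1}"
      unfolding S using ab(1-3) by auto
    ultimately have "{1..n} - S = {a + 1..b - 1}" "a + 1 \<le> b - 1"
      by auto
    then show ?thesis
      using is_interval_Zn_atLeastAtMost[of "a + 1" "b - 1" n] ab(3) by simp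
  qed
qed

lemma permutes_image_prefix_Compl:
  fixes \<sigma> :: "nat \<Rightarrow> nat"
  assumes "\<sigma> permutes {1..n}" "j \<le> n"
  shows "\<sigma> ` {j + 1..n} = {1..n} - \<sigma> ` {1..j}"
proof -
  have "{j + 1..n} = {1..n} - {1..j}" by auto
  then show ?thesis
    using permutes_image[OF assms(1)] image_set_diff[OF permutes_inj[OF assms(1)]] by metis
qed

lemma arc_permutations_longest_perm_left:
  assumes "\<sigma> \<in> arc_permutations n"
  shows "longest_perm n \<circ> \<sigma> \<in> arc_permutations n"
  using assms is_interval_Zn_longest_perm longest_perm_permutes
  unfolding arc_permutations_def mem_Collect_eq image_comp[symmetric]
  by (blast intro: permutes_compose)

text \<open>A proper suffix is the complement of a proper prefix.\<close>

lemma arc_permutations_suffix: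
  assumes "\<sigma> \<in> arc_permutations n" "k \<in> {1..n}"
  shows "is_interval_Zn n (\<sigma> ` {k..n})"
proof (cases "k = 1")
  case True
  then show ?thesis
    using assms by (auto simp: arc_permutations_def)
next
  case False
  then obtain j where j: "k = j + 1" "1 \<le> j" "j < n"
    using assms(2) by (cases k) auto
  have perm: "\<sigma> permutes {1..n}"
    using assms(1) by (rule arc_permutations_permutes)
  have "card (\<sigma> ` {1..j}) = j"
    using card_image[OF permutes_inj_on[OF perm], of "{1..j}"] by simp
  then have "\<sigma> ` {1..j} \<noteq> {1..n}"
    using j by auto
  moreover have "is_interval_Zn n (\<sigma> ` {1..j})"
    using assms(1) j by (auto simp: arc_permutations_def)
  ultimately show ?thesis
    using is_interval_Zn_Compl permutes_image_prefix_Compl[OF perm, of j] j by simp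
qed

text \<open>Reversing the word turns prefixes into suffixes, which are cyclic intervals as
  well.\<close>

lemma arc_permutations_longest_perm_right:
  assumes "\<sigma> \<in> arc_permutations n"
  shows "\<sigma> \<circ> longest_perm n \<in> arc_permutations n"
  unfolding arc_permutations_def
proof (intro CollectI conjI ballI)
  show "\<sigma> \<circ> longest_perm n permutes {1..n}"
    using arc_permutations_permutes[OF assms] longest_perm_permutes by (intro permutes_compose)
  fix j assume j: "j \<in> {1..n}"
  then have "n + 1 - j \<in> {1..n}"
    by auto
  from arc_permutations_suffix[OF assms this] j
  show "is_interval_Zn n ((\<sigma> \<circ> longest_perm n) ` {1..j})"
    unfolding image_comp[symmetric] by (subst longest_perm_image_atLeastAtMost) auto
qed

text \<open>Complementing the letters keeps the positions and turns the ascent at \<open>i\<close>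
  into a descent.\<close>

lemma ascent_step_longest_perm_left:
  assumes "ascent_step n \<sigma> \<tau>"
  shows "ascent_step n (longest_perm n \<circ> \<tau>) (longest_perm n \<circ> \<sigma>)"
proof -
  obtain i where i: "1 \<le> i" "i < n" "\<sigma> i < \<sigma> (i + 1)" "\<tau> = \<sigma> \<circ> transpose i (i + 1)"
    and arc: "\<sigma> \<in> arc_permutations n" "\<tau> \<in> arc_permutations n"
    using assms by (auto simp: ascent_step_def)
  have "\<sigma> k \<in> {1..n}" if "k \<in> {1..n}" for k
    using permutes_in_image[OF arc_permutations_permutes[OF arc(1)]] that by blast
  from this[of i] this[of "i + 1"] i
  have "(longest_perm n \<circ> \<tau>) i < (longest_perm n \<circ> \<tau>) (i + 1)"
    by (auto simp: longest_perm_def)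
  moreover have "longest_perm n \<circ> \<sigma> = (longest_perm n \<circ> \<tau>) \<circ> transpose i (i + 1)"
    using i by (simp add: comp_assoc)
  ultimately show ?thesis
    unfolding ascent_step_def using i arc by (blast intro: arc_permutations_longest_perm_left)
qed

text \<open>Reversing the word moves the ascent at \<open>i\<close> to a descent at
  \<open>n - i\<close>.\<close>

lemma ascent_step_longest_perm_right:
  assumes "ascent_step n \<sigma> \<tau>"
  shows "ascent_step n (\<tau> \<circ> longest_perm n) (\<sigma> \<circ> longest_perm n)"
proof -
  obtain i where i: "1 \<le> i" "i < n" "\<sigma> i < \<sigma> (i + 1)" "\<tau> = \<sigma> \<circ> transpose i (i + 1)"
    and arc: "\<sigma> \<in> arc_permutations n" "\<tau> \<in> arc_permutations n"
    using assms by (auto simp: ascent_step_def)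
  have w: "longest_perm n (n - i) = i + 1" "longest_perm n (n - i + 1) = i"
    using i by (auto simp: longest_perm_def)
  \<comment> \<open>Conjugation by \<open>longest_perm n\<close> carries one adjacent transposition
    to the other.\<close>
  have swap: "transpose i (i + 1) (longest_perm n k) =
      longest_perm n (transpose (n - i) (n - i + 1) k)" for k
    using w by (metis longest_perm_invol transpose_apply_first transpose_apply_other
        transpose_apply_second)
  have "\<sigma> \<circ> longest_perm n = (\<tau> \<circ> longest_perm n) \<circ> transpose (n - i) (n - i + 1)"
    using swap i(4) by (auto simp: fun_eq_iff swap[symmetric] simp del: One_nat_def add_Suc_right)
  moreover have "(\<tau> \<circ> longest_perm n) (n - i) < (\<tau> \<circ> longest_perm n) (n - i + 1)"
    using i w by simp
  moreover have "1 \<le> n - i" "n - i < n"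
    using i by auto
  ultimately show ?thesis
    unfolding ascent_step_def using arc by (blast intro: arc_permutations_longest_perm_right)
qed

lemma rtranclp_map_converse:
  assumes "\<And>x y. R x y \<Longrightarrow> R (f y) (f x)" "R\<^sup>*\<^sup>* x y"
  shows "R\<^sup>*\<^sup>* (f y) (f x)"
  using assms(2)
proof (induction rule: rtranclp_induct)
  case (step y z)
  then show ?case
    using assms(1) by (meson converse_rtranclp_into_rtranclp)
qed simp

lemma ascents_longest_perm_left:
  assumes "(ascent_step n)\<^sup>*\<^sup>* \<sigma> \<tau>"
  shows "(ascent_step n)\<^sup>*\<^sup>* (longest_perm n \<circ> \<tau>) (longest_perm n \<circ> \<sigma>)"
  using rtranclp_map_converse[of "ascent_step n" "\<lambda>\<rho>. longest_perm n \<circ> \<rho>"]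
    ascent_step_longest_perm_left assms by blast

lemma ascents_longest_perm_right:
  assumes "(ascent_step n)\<^sup>*\<^sup>* \<sigma> \<tau>"
  shows "(ascent_step n)\<^sup>*\<^sup>* (\<tau> \<circ> longest_perm n) (\<sigma> \<circ> longest_perm n)"
  using rtranclp_map_converse[of "ascent_step n" "\<lambda>\<rho>. \<rho> \<circ> longest_perm n"]
    ascent_step_longest_perm_right assms by blast

section \<open>Ascending paths through unimodal permutations\<close>

text \<open>One half of unimodality; the suffix half is this condition for the reversed word
  \<open>\<pi> \<circ> longest_perm n\<close>.\<close>

definition prefix_unimodal :: "nat \<Rightarrow> (nat \<Rightarrow> nat) \<Rightarrow> bool" where
  "prefix_unimodal n \<pi> \<longleftrightarrow> \<pi> permutes {1..n} \<and> (\<forall>j\<in>{1..n}. is_interval_Z (\<pi> ` {1..j}))"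

lemma prefix_unimodal_arc:
  assumes "prefix_unimodal n \<sigma>"
  shows "\<sigma> \<in> arc_permutations n"
  unfolding arc_permutations_def
proof (intro CollectI conjI ballI)
  show perm: "\<sigma> permutes {1..n}"
    using assms by (simp add: prefix_unimodal_def)
  fix j assume j: "j \<in> {1..n}"
  obtain a b where ab: "a \<le> b" "\<sigma> ` {1..j} = {a..b}"
    using assms j unfolding prefix_unimodal_def is_interval_Z_def by blast
  have "{a..b} \<subseteq> {1..n}"
    using image_mono[of "{1..j}" "{1..n}" \<sigma>] j unfolding ab(2) permutes_image[OF perm] by simp
  with ab show "is_interval_Zn n (\<sigma> ` {1..j})"
    by (auto intro: is_interval_Zn_atLeastAtMost)
qed

lemma prefix_unimodal_longest_perm_left:
  assumes "prefix_unimodal n \<sigma>"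
  shows "prefix_unimodal n (longest_perm n \<circ> \<sigma>)"
  unfolding prefix_unimodal_def
proof (intro conjI ballI)
  have perm: "\<sigma> permutes {1..n}"
    using assms by (simp add: prefix_unimodal_def)
  then show "longest_perm n \<circ> \<sigma> permutes {1..n}"
    using longest_perm_permutes by (rule permutes_compose)
  fix j assume j: "j \<in> {1..n}"
  obtain a b where ab: "a \<le> b" "\<sigma> ` {1..j} = {a..b}"
    using assms j unfolding prefix_unimodal_def is_interval_Z_def by blast
  have "{a..b} \<subseteq> {1..n}"
    using image_mono[of "{1..j}" "{1..n}" \<sigma>] j unfolding ab(2) permutes_image[OF perm] by simp
  then have "1 \<le> a" "b \<le> n"
    using ab(1) by auto
  then have "(longest_perm n \<circ> \<sigma>) ` {1..j} = {n + 1 - b..n + 1 - a}"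
    using ab by (simp only: image_comp[symmetric] longest_perm_image_atLeastAtMost)
  then show "is_interval_Z ((longest_perm n \<circ> \<sigma>) ` {1..j})"
    unfolding is_interval_Z_def using ab(1)
    by (intro exI[of _ "n + 1 - b"] exI[of _ "n + 1 - a"]) auto
qed

text \<open>By convexity the neighbour of the block on the side of \<open>x\<close> lies in
  \<open>{c..d}\<close>, so it must be \<open>x\<close>. Writing \<open>x + 1 = a\<close> avoids
  truncated subtraction.\<close>

lemma insert_interval_cases:
  assumes "insert x {a..<a + k} = {c..d}" "x \<notin> {a..<a + k}" "0 < k"
  shows "x = a + k \<or> x + 1 = (a::nat)"
proof (cases "x < a")
  case True
  have "x \<in> {c..d}" "a \<in> {c..d}"
    using assms by (auto simp: assms(1)[symmetric])
  then have "x + 1 \<in> {c..d}"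
    using True by auto
  then show ?thesis
    using True by (auto simp: assms(1)[symmetric])
next
  case False
  then have x: "a + k \<le> x"
    using assms(2) by auto
  have "x \<in> {c..d}" "a + k - 1 \<in> {c..d}"
    using assms(3) by (auto simp: assms(1)[symmetric])
  then have "a + k \<in> {c..d}"
    using x by auto
  then show ?thesis
    by (auto simp: assms(1)[symmetric])
qed

text \<open>Strict growth gives \<open>i \<le> \<sigma> i\<close>, which forces a permutation of
  \<open>{1..n}\<close> to be the identity. This supplies a descent whenever
  \<open>\<sigma> \<noteq> id\<close>.\<close>

lemma permutes_ascending_imp_id:
  fixes n :: nat
  assumes perm: "\<sigma> permutes {1..n}" and asc: "\<And>i. 1 \<le> i \<Longrightarrow> i < n \<Longrightarrow> \<sigma> i < \<sigma> (i + 1)"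
  shows "\<sigma> = id"
proof -
  have "i \<le> \<sigma> i" if "i \<in> {1..n}" for i
    using that
  proof (induction i)
    case (Suc i)
    show ?case
    proof (cases "i = 0")
      case True
      then show ?thesis
        using permutes_in_image[OF perm, of 1] Suc.prems by auto
    next
      case False
      then show ?thesis
        using Suc asc[of i] by simp
    qed
  qed simp
  then show ?thesis
    using permutes_natset_ge[OF perm] by blast
qed

text \<open>Up to the first descent \<open>i\<close> the values are consecutive, so \<open>\<sigma> (i + 1)\<close> extends the
  interval downwards and may be moved one position to the left.\<close>

lemma prefix_unimodal_descent:
  assumes "prefix_unimodal n \<sigma>" "\<sigma> \<noteq> id"
  obtains \<tau> where "prefix_unimodal n \<tau>" "ascent_step n \<tau> \<sigma>"
proof -
  have perm: "\<sigma> permutes {1..n}"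
    and interval: "\<And>j. j \<in> {1..n} \<Longrightarrow> is_interval_Z (\<sigma> ` {1..j})"
    using assms(1) by (auto simp: prefix_unimodal_def)
  have inj: "\<sigma> i = \<sigma> j \<longleftrightarrow> i = j" for i j
    using permutes_inj[OF perm] by (simp add: inj_eq)
  define descent where "descent i \<longleftrightarrow> 1 \<le> i \<and> i < n \<and> \<sigma> (i + 1) < \<sigma> i" for i
  define i where "i = (LEAST i. descent i)"
  have "\<exists>i. descent i"
  proof (rule ccontr)
    assume "\<nexists>i. descent i"
    then have "\<sigma> i < \<sigma> (i + 1)" if "1 \<le> i" "i < n" for i
      using that inj[of i "i + 1"]
      unfolding descent_def by (metis linorder_neqE_nat n_not_Suc_n Suc_eq_plus1)
    from permutes_ascending_imp_id[OF perm this] assms(2) show False by blast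
  qed
  then have "descent i"
    unfolding i_def by (rule LeastI_ex)
  then have i: "1 \<le> i" "i < n" "\<sigma> (i + 1) < \<sigma> i"
    by (simp_all add: descent_def)
  have asc: "\<sigma> k < \<sigma> (k + 1)" if "1 \<le> k" "k < i" for k
  proof -
    have "\<not> descent k"
      using that(2) unfolding i_def by (rule not_less_Least)
    then show ?thesis
      using that i(2) inj[of k "k + 1"] by (auto simp: descent_def)
  qed
  have next_value: "\<sigma> (k + 1) = a + k \<or> \<sigma> (k + 1) + 1 = a"
    if "\<sigma> ` {1..k} = {a..<a + k}" "1 \<le> k" "k < n" for k a
  proof -
    have "{1..k + 1} = insert (k + 1) {1..k}"
      by auto
    then have "is_interval_Z (insert (\<sigma> (k + 1)) {a..<a + k})"
      using interval[of "k + 1"] that by simp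
    moreover have "\<sigma> (k + 1) \<notin> \<sigma> ` {1..k}"
      by (auto simp: inj)
    ultimately show ?thesis
      using insert_interval_cases[of "\<sigma> (k + 1)" a k] that unfolding is_interval_Z_def by auto
  qed
  define a where "a = \<sigma> 1"
  \<comment> \<open>With only ascents so far, each new letter extends the interval upwards.\<close>
  have run: "\<sigma> ` {1..k} = {a..<a + k} \<and> \<sigma> k = a + k - 1" if "1 \<le> k" "k \<le> i" for k
    using that
  proof (induction k rule: dec_induct)
    case (step k)
    then have IH: "\<sigma> ` {1..k} = {a..<a + k}" "\<sigma> k = a + k - 1"
      by auto
    have "\<sigma> (k + 1) = a + k"
      using next_value[OF IH(1)] asc[of k] IH(2) step i(2) by auto
    moreover have "{1..Suc k} = insert (Suc k) {1..k}"
      by auto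
    ultimately show ?case
      using IH(1) by auto
  qed (auto simp: a_def)
  \<comment> \<open>The descent rules out the upward extension.\<close>
  have low: "\<sigma> (i + 1) + 1 = a"
    using next_value[of i a] run[of i] i by auto
  define \<tau> where "\<tau> = \<sigma> \<circ> transpose i (i + 1)"
  have "prefix_unimodal n \<tau>"
    unfolding prefix_unimodal_def
  proof (intro conjI ballI)
    show "\<tau> permutes {1..n}"
      unfolding \<tau>_def using i perm by (intro permutes_compose permutes_swap_id) auto
    fix j assume j: "j \<in> {1..n}"
    show "is_interval_Z (\<tau> ` {1..j})"
    \<comment> \<open>Every prefix of another length contains both exchanged positions or neither,
      so its image is unchanged.\<close>
    proof (cases "j = i")
      case True
      have "\<tau> ` {1..i} = insert (\<tau> i) (\<tau> ` {1..i - 1})"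
        using i(1) by (cases i) (auto simp: atLeastAtMostSuc_conv)
      also have "\<tau> ` {1..i - 1} = \<sigma> ` {1..i - 1}"
        by (intro image_cong) (auto simp: \<tau>_def)
      also have "\<dots> = {a..<a + (i - 1)}"
        using run[of "i - 1"] i(1) by (cases "i = 1") (simp_all del: One_nat_def)
      \<comment> \<open>By \<open>low\<close>, \<open>a\<close> is positive, so \<open>a - 1\<close>
        is the true predecessor, namely the letter moved to position \<open>i\<close>.\<close>
      also have "insert (\<tau> i) \<dots> = {a - 1..a + i - 2}"
        using low i(1) by (auto simp: \<tau>_def)
      finally have "\<tau> ` {1..j} = {a - 1..a + i - 2}"
        using True by simp
      moreover have "a - 1 \<le> a + i - 2"
        using i(1) by simp
      ultimately show ?thesis
        unfolding is_interval_Z_def by blast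
    next
      case False
      have "transpose i (i + 1) ` {1..j} = {1..j}"
        using False i(1) by (intro transpose_image_eq) auto
      then have "\<tau> ` {1..j} = \<sigma> ` {1..j}"
        unfolding \<tau>_def image_comp[symmetric] by simp
      then show ?thesis
        using interval[OF j] by simp
    qed
  qed
  moreover have "ascent_step n \<tau> \<sigma>"
    unfolding ascent_step_def
  proof (intro conjI exI)
    show "\<tau> \<in> arc_permutations n" "\<sigma> \<in> arc_permutations n"
      using prefix_unimodal_arc assms(1) \<open>prefix_unimodal n \<tau>\<close> by blast+
    show "\<sigma> = \<tau> \<circ> transpose i (i + 1)"
      by (simp add: \<tau>_def comp_assoc)
    show "\<tau> i < \<tau> (i + 1)"
      using i(3) by (simp add: \<tau>_def)
  qed (use i in auto)
  ultimately show thesis by (rule that)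
qed

text \<open>Undoing descents inside the class loses one inversion each time and stops only at
  \<open>id\<close>.\<close>

lemma prefix_unimodal_ascents:
  assumes "prefix_unimodal n \<sigma>"
  shows "(ascent_step n)\<^sup>*\<^sup>* id \<sigma>"
  using assms
proof (induction "card (inversions \<sigma>)" arbitrary: \<sigma> rule: less_induct)
  case less
  show ?case
  proof (cases "\<sigma> = id")
    case False
    then obtain \<tau> where "prefix_unimodal n \<tau>" "ascent_step n \<tau> \<sigma>"
      using less.prems by (blast elim: prefix_unimodal_descent)
    with less.hyps[of \<tau>] show ?thesis
      by (simp add: card_inversions_ascent_step rtranclp.rtrancl_into_rtrancl)
  qed simp
qed

text \<open>Left multiplication reverses the ascents from \<open>id\<close> to
  \<open>longest_perm n \<circ> \<sigma>\<close>.\<close>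

lemma prefix_unimodal_ascents_longest_perm:
  assumes "prefix_unimodal n \<sigma>"
  shows "(ascent_step n)\<^sup>*\<^sup>* \<sigma> (longest_perm n)"
  using prefix_unimodal_longest_perm_left[OF assms, THEN prefix_unimodal_ascents,
      THEN ascents_longest_perm_left]
  by (simp add: comp_assoc[symmetric])

lemma unimodal_cases:
  assumes "unimodal n \<sigma>"
  shows "prefix_unimodal n \<sigma> \<or> prefix_unimodal n (\<sigma> \<circ> longest_perm n)"
proof (cases "prefix_unimodal n \<sigma>")
  case False
  have perm: "\<sigma> permutes {1..n}" and suffix: "\<And>j. j \<in> {1..n} \<Longrightarrow> is_interval_Z (\<sigma> ` {j..n})"
    using assms False by (auto simp: unimodal_def prefix_unimodal_def)
  have "is_interval_Z ((\<sigma> \<circ> longest_perm n) ` {1..j})" if j: "j \<in> {1..n}" for j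
  proof -
    have "n + 1 - j \<in> {1..n}"
      using j by auto
    from suffix[OF this] j show ?thesis
      unfolding image_comp[symmetric] by (subst longest_perm_image_atLeastAtMost) auto
  qed
  then show ?thesis
    using perm longest_perm_permutes by (auto simp: prefix_unimodal_def intro!: permutes_compose)
qed simp

lemma unimodal_ascents:
  assumes "unimodal n \<sigma>"
  shows "(ascent_step n)\<^sup>*\<^sup>* id \<sigma>" "(ascent_step n)\<^sup>*\<^sup>* \<sigma> (longest_perm n)"
  using unimodal_cases[OF assms]
proof (atomize (full), elim disjE)
  assume "prefix_unimodal n (\<sigma> \<circ> longest_perm n)"
  \<comment> \<open>Right multiplication reverses both chains, so the lower one becomes the upper
    one and conversely.\<close>
  from prefix_unimodal_ascents[OF this] prefix_unimodal_ascents_longest_perm[OF this]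
  show "(ascent_step n)\<^sup>*\<^sup>* id \<sigma> \<and> (ascent_step n)\<^sup>*\<^sup>* \<sigma> (longest_perm n)"
    using ascents_longest_perm_right[of n id "\<sigma> \<circ> longest_perm n"]
      ascents_longest_perm_right[of n "\<sigma> \<circ> longest_perm n" "longest_perm n"]
    by (simp add: comp_assoc)
qed (simp add: prefix_unimodal_ascents prefix_unimodal_ascents_longest_perm)

section \<open>Permutations that are not unimodal\<close>

lemma arc_permutations_not_crossing:
  assumes "\<sigma> \<in> arc_permutations n" "1 < a" "a < b" "b < n"
    and "inv \<sigma> a < inv \<sigma> n" "inv \<sigma> n < inv \<sigma> 1" "inv \<sigma> n < inv \<sigma> b"
  shows False
proof -
  have perm: "\<sigma> permutes {1..n}"
    using assms(1) by (rule arc_permutations_permutes)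
  have img: "x \<in> \<sigma> ` {1..inv \<sigma> n} \<longleftrightarrow> inv \<sigma> x \<in> {1..inv \<sigma> n}" for x
    using permutes_inverses[OF perm] by (metis image_iff)
  have pos: "inv \<sigma> x \<in> {1..n} \<longleftrightarrow> x \<in> {1..n}" for x
    by (rule permutes_in_image[OF permutes_inv[OF perm]])
  let ?S = "\<sigma> ` {1..inv \<sigma> n}"
  \<comment> \<open>An arc joining \<open>a\<close> to \<open>n\<close> either passes through
    \<open>b\<close> or wraps around through \<open>1\<close>.\<close>
  have not_crossing: "1 \<in> S \<or> b \<in> S" if "is_interval_Zn n S" "a \<in> S" "n \<in> S" for S
    using that assms(2-4) unfolding is_interval_Zn_def by auto
  have "is_interval_Zn n ?S"
    using assms pos[of n] by (auto simp: arc_permutations_def)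
  moreover have "a \<in> ?S" "n \<in> ?S" "1 \<notin> ?S" "b \<notin> ?S"
    unfolding img using assms pos[of n] pos[of a] by auto
  ultimately show False
    using assms(2-4) not_crossing[of ?S] by blast
qed

text \<open>Only adjacent letters of the chain \<open>a, 1, n, b\<close> could change order. The
  pairs \<open>a, 1\<close> and \<open>n, b\<close> are descending and cannot be exchanged by an
  ascent.\<close>

lemma ascent_step_preserves_order:
  assumes "ascent_step n \<sigma> \<tau>" "1 < a" "a < b" "b < n"
    and "inv \<sigma> a < inv \<sigma> 1" "inv \<sigma> 1 < inv \<sigma> n" "inv \<sigma> n < inv \<sigma> b"
  shows "inv \<tau> a < inv \<tau> 1 \<and> inv \<tau> 1 < inv \<tau> n \<and> inv \<tau> n < inv \<tau> b"
proof -
  obtain i where i: "\<sigma> i < \<sigma> (i + 1)" "\<tau> = \<sigma> \<circ> transpose i (i + 1)"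
    and arc: "\<sigma> \<in> arc_permutations n" "\<tau> \<in> arc_permutations n"
    using assms(1) by (auto simp: ascent_step_def)
  have perm: "\<sigma> permutes {1..n}"
    using arc(1) by (rule arc_permutations_permutes)
  have val: "\<sigma> (inv \<sigma> x) = x" for x
    using permutes_inverses[OF perm] by simp
  have inv\<tau>: "inv \<tau> x = transpose i (Suc i) (inv \<sigma> x)" for x
    using i(2) inv_comp_transpose[OF permutes_bij[OF perm]] by simp
  have less: "inv \<tau> x < inv \<tau> y" if "inv \<sigma> x < inv \<sigma> y" "\<not> (inv \<sigma> x = i \<and> inv \<sigma> y = Suc i)" for x y
    unfolding inv\<tau> using that by (intro transpose_Suc_strict_mono) auto
  have a1: "inv \<tau> a < inv \<tau> 1"
    using less[OF assms(5)] i(1) val[of a] val[of 1] assms(2) by fastforce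
  have nb: "inv \<tau> n < inv \<tau> b"
    using less[OF assms(7)] i(1) val[of n] val[of b] assms(4) by fastforce
  have "inv \<tau> 1 < inv \<tau> n"
  proof (cases "inv \<sigma> 1 = i \<and> inv \<sigma> n = Suc i")
    case True
    \<comment> \<open>The exchange would produce the order \<open>a, n, 1, b\<close>, which no arc
      permutation has.\<close>
    then have "inv \<tau> n < inv \<tau> 1" "inv \<tau> a < inv \<tau> n"
      using assms(5) by (auto simp: inv\<tau> transpose_def)
    then show ?thesis
      using arc_permutations_not_crossing[OF arc(2) assms(2-4)] nb by blast
  qed (use less[OF assms(6)] in blast)
  with a1 nb show ?thesis by blast
qed

text \<open>The order \<open>a, 1, n, b\<close> persists along ascents, but
  \<open>longest_perm n\<close> has \<open>n\<close> before \<open>1\<close>.\<close>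

lemma no_ascents_to_longest_perm:
  assumes "\<sigma> \<in> arc_permutations n" "1 < \<sigma> 1" "\<sigma> 1 < \<sigma> n" "\<sigma> n < n"
  shows "\<not> (ascent_step n)\<^sup>*\<^sup>* \<sigma> (longest_perm n)"
proof
  assume *: "(ascent_step n)\<^sup>*\<^sup>* \<sigma> (longest_perm n)"
  define a b where "a = \<sigma> 1" and "b = \<sigma> n"
  note ab = assms(2-4)[folded a_def b_def]
  have perm: "\<sigma> permutes {1..n}"
    using assms(1) by (rule arc_permutations_permutes)
  have pos: "inv \<sigma> x \<in> {1..n} \<longleftrightarrow> x \<in> {1..n}" for x
    by (rule permutes_in_image[OF permutes_inv[OF perm]])
  have val: "\<sigma> (inv \<sigma> x) = x" for x
    using permutes_inverses[OF perm] by simp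
  have inv_ab: "inv \<sigma> a = 1" "inv \<sigma> b = n"
    using permutes_inverses[OF perm] by (simp_all add: a_def b_def)
  have first: "1 < inv \<sigma> x" if "x \<in> {1..n}" "x \<noteq> a" for x
    using that pos[of x] val[of x] by (cases "inv \<sigma> x = 1") (auto simp: a_def)
  have last: "inv \<sigma> x < n" if "x \<in> {1..n}" "x \<noteq> b" for x
    using that pos[of x] val[of x] by (cases "inv \<sigma> x = n") (auto simp: b_def)
  \<comment> \<open>Since \<open>a\<close> comes first and \<open>b\<close> last, \<open>n\<close>
    before \<open>1\<close> would be a crossing in \<open>\<sigma>\<close> itself.\<close>
  have "\<not> inv \<sigma> n < inv \<sigma> 1"
    using arc_permutations_not_crossing[OF assms(1) ab] first[of n] last[of n] inv_ab ab by auto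
  moreover have "inv \<sigma> n \<noteq> inv \<sigma> 1"
    using val[of n] val[of 1] ab by auto
  ultimately have start: "inv \<sigma> a < inv \<sigma> 1 \<and> inv \<sigma> 1 < inv \<sigma> n \<and> inv \<sigma> n < inv \<sigma> b"
    using first[of 1] last[of n] inv_ab ab by auto
  from * have "inv (longest_perm n) a < inv (longest_perm n) 1 \<and>
      inv (longest_perm n) 1 < inv (longest_perm n) n \<and> inv (longest_perm n) n < inv (longest_perm n) b"
  proof (induction rule: rtranclp_induct)
    case (step \<tau> \<rho>)
    then show ?case using ascent_step_preserves_order[OF step(2) ab] by blast
  qed (rule start)
  moreover have "inv (longest_perm n) = longest_perm n"
    by (rule inv_equality) simp_all
  ultimately show False
    by (auto simp: longest_perm_def split: if_splits)
qed

text \<open>A wrapping interval contains both \<open>1\<close> and \<open>n\<close>.\<close>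

lemma is_interval_Zn_imp_Z:
  assumes "is_interval_Zn n S" "x \<in> {1, n}" "x \<notin> S"
  shows "is_interval_Z S"
  using assms unfolding is_interval_Zn_def is_interval_Z_def by fastforce

text \<open>An extreme letter in the last position is missing from all proper prefixes, so none of
  them wraps; in the first position it does the same for suffixes.\<close>

lemma not_unimodal_ends:
  assumes "\<sigma> \<in> arc_permutations n" "\<not> unimodal n \<sigma>"
  shows "\<sigma> 1 \<notin> {1, n}" "\<sigma> n \<notin> {1, n}"
proof -
  have perm: "\<sigma> permutes {1..n}"
    using assms(1) by (rule arc_permutations_permutes)
  have inj: "\<sigma> i = \<sigma> j \<longleftrightarrow> i = j" for i j
    using permutes_inj[OF perm] by (simp add: inj_eq)
  have whole: "is_interval_Z (\<sigma> ` {1..n})" if "1 \<le> n"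
    using that permutes_image[OF perm] by (auto simp: is_interval_Z_def)
  show "\<sigma> n \<notin> {1, n}"
  proof
    assume n: "\<sigma> n \<in> {1, n}"
    have "is_interval_Z (\<sigma> ` {1..j})" if j: "j \<in> {1..n}" for j
    proof (cases "j = n")
      case False
      then have "\<sigma> n \<notin> \<sigma> ` {1..j}"
        using j inj by auto
      then show ?thesis
        using is_interval_Zn_imp_Z[OF _ n] assms(1) j by (auto simp: arc_permutations_def)
    qed (use whole j in auto)
    with assms(2) perm show False by (auto simp: unimodal_def)
  qed
  show "\<sigma> 1 \<notin> {1, n}"
  proof
    assume n: "\<sigma> 1 \<in> {1, n}"
    have "is_interval_Z (\<sigma> ` {j..n})" if j: "j \<in> {1..n}" for j
    proof (cases "j = 1")
      case False
      then have "\<sigma> 1 \<notin> \<sigma> ` {j..n}"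
        using j inj by auto
      then show ?thesis
        using is_interval_Zn_imp_Z[OF _ n] arc_permutations_suffix[OF assms(1) j] by blast
    qed (use whole j in auto)
    with assms(2) perm show False by (auto simp: unimodal_def)
  qed
qed

lemma ascents_imp_unimodal:
  assumes arc: "\<sigma> \<in> arc_permutations n"
    and "(ascent_step n)\<^sup>*\<^sup>* id \<sigma>" "(ascent_step n)\<^sup>*\<^sup>* \<sigma> (longest_perm n)"
  shows "unimodal n \<sigma>"
proof (rule ccontr)
  assume not: "\<not> unimodal n \<sigma>"
  have perm: "\<sigma> permutes {1..n}"
    using arc by (rule arc_permutations_permutes)
  have "n \<noteq> 0"
    using not perm by (auto simp: unimodal_def)
  moreover have "n \<noteq> 1"
    using not_unimodal_ends[OF arc not] permutes_in_image[OF perm, of 1] by auto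
  ultimately have n: "1 < n" by simp
  have in_n: "\<sigma> 1 \<in> {1..n}" "\<sigma> n \<in> {1..n}"
    using permutes_in_image[OF perm] n by auto
  have bounds: "1 < \<sigma> 1" "\<sigma> 1 < n" "1 < \<sigma> n" "\<sigma> n < n"
    using not_unimodal_ends[OF arc not] in_n by auto
  have "\<sigma> 1 \<noteq> \<sigma> n"
    using permutes_inj[OF perm] n by (simp add: inj_eq)
  then consider "\<sigma> 1 < \<sigma> n" | "\<sigma> n < \<sigma> 1" by linarith
  then show False
  proof cases
    case 1
    then show False
      using no_ascents_to_longest_perm[OF arc] bounds assms(3) by blast
  next
    case 2
    \<comment> \<open>Complementing the letters reverses \<open>\<sigma> n < \<sigma> 1\<close> and
      turns the ascents from \<open>id\<close> to \<open>\<sigma>\<close> into ascents from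
      \<open>?\<tau>\<close> to \<open>longest_perm n\<close>.\<close>
    let ?\<tau> = "longest_perm n \<circ> \<sigma>"
    have "1 < ?\<tau> 1" "?\<tau> 1 < ?\<tau> n" "?\<tau> n < n"
      using 2 bounds by (auto simp: longest_perm_def)
    moreover have "(ascent_step n)\<^sup>*\<^sup>* ?\<tau> (longest_perm n)"
      using ascents_longest_perm_left[OF assms(2)] by simp
    ultimately show False
      using no_ascents_to_longest_perm[OF arc_permutations_longest_perm_left[OF arc]] by blast
  qed
qed

section \<open>Geodesics\<close>

lemma prefix_unimodal_id: "prefix_unimodal n id"
  by (auto simp: prefix_unimodal_def is_interval_Z_def permutes_id)

text \<open>The number of inversions of \<open>longest_perm n\<close> bounds all path lengths from
  below and is attained exactly by ascending paths.\<close>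

lemma geodesic_iff_ascending:
  "geodesic (with_proj (arc_graph n)) id (longest_perm n) p \<longleftrightarrow>
     successively (ascent_step n) p \<and> p \<noteq> [] \<and> hd p = id \<and> last p = longest_perm n"
  (is "geodesic ?G _ _ p \<longleftrightarrow> ?asc p")
proof -
  let ?N = "card (inversions (longest_perm n))"
  have id_arc: "id \<in> arc_permutations n"
    by (rule prefix_unimodal_arc) (simp add: prefix_unimodal_id)
  have asc: "vpath q ?G" "vwalk_length q = ?N" if "?asc q" for q
  proof -
    from that have q: "successively (ascent_step n) q" "q \<noteq> []" "hd q = id"
      "last q = longest_perm n"
      by blast+
    note * = ascending_vpath[OF q(1,2), unfolded q(3,4) inversions_id, OF id_arc]
    show "vpath q ?G" "vwalk_length q = ?N"
      using * by simp_all
  qed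
  have bound: "?N \<le> vwalk_length q" "vwalk_length q = ?N \<Longrightarrow> ?asc q"
    if "vpath q ?G" "hd q = id" "last q = longest_perm n" for q
    using vwalk_inversions_le[of q n] that
    by (auto simp: vpath_def vwalk_def inversions_id simp del: eq_id_iff)
  \<comment> \<open>One ascending path must exist for the lower bound to be the distance;
    \<open>id\<close>, being prefix-unimodal, provides it.\<close>
  obtain q where q: "?asc q"
    using prefix_unimodal_ascents_longest_perm[OF prefix_unimodal_id]
    by (metis rtranclp_imp_successively)
  show ?thesis
  proof
    assume p: "geodesic ?G id (longest_perm n) p"
    then have "vwalk_length p \<le> vwalk_length q"
      using q asc(1)[OF q] unfolding geodesic_def by blast
    then show "?asc p"
      using p asc(2)[OF q] bound[of p] by (auto simp: geodesic_def)
  next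
    assume "?asc p"
    with asc[OF this] bound(1) show "geodesic ?G id (longest_perm n) p"
      by (auto simp: geodesic_def)
  qed
qed

theorem lemma6p4:
  fixes n :: nat and \<pi> :: "nat \<Rightarrow> nat"
  assumes "\<pi> \<in> arc_permutations n"
  shows "(\<exists>p. geodesic (with_proj (arc_graph n)) id (longest_perm n) p \<and> \<pi> \<in> set p)
           \<longleftrightarrow> unimodal n \<pi>"
proof
  assume "\<exists>p. geodesic (with_proj (arc_graph n)) id (longest_perm n) p \<and> \<pi> \<in> set p"
  then obtain p where p: "successively (ascent_step n) p" "hd p = id" "last p = longest_perm n"
    "\<pi> \<in> set p"
    by (auto simp: geodesic_iff_ascending)
  show "unimodal n \<pi>"
    using ascents_imp_unimodal[OF assms] successively_through_imp_rtranclp[OF p(1,4)] p(2,3) by simp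
next
  assume "unimodal n \<pi>"
  from unimodal_ascents[OF this] obtain p where "successively (ascent_step n) p" "p \<noteq> []"
    "hd p = id" "last p = longest_perm n" "\<pi> \<in> set p"
    by (rule rtranclp_through_imp_successively)
  then show "\<exists>p. geodesic (with_proj (arc_graph n)) id (longest_perm n) p \<and> \<pi> \<in> set p"
    by (auto simp: geodesic_iff_ascending)
qed

end
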